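(* Let $G$ be a graph with $n$ vertices and let $F=\sum_{i=1}^n d_i^3$. Then $$\sqrt{2F+n(n-1)\left(|\det\mathcal{S}(G)|\right)^{2/n}}\leq \mathcal{E}(G)\leq \sqrt{2(n-1)F+n\left(|\det\mathcal{S}(G)|\right)^{2/n}}.$$
   Context: $G$ is a simple undirected graph on vertices $v_1,\dots,v_n$ with degrees $d_i$. The Sombor matrix $\mathcal{S}(G)$ has $(i,j)$-entry $\sqrt{d_i^2+d_j^2}$ if $v_i,v_j$ are adjacent and $0$ otherwise, with eigenvalues $\rho_1,\dots,\rho_n$. The Sombor energy is $\mathcal{E}(G)=\sum_{i=1}^n|\rho_i|$. *)

theory Defs
  imports
    Complex_Main
    "HOL-Computational_Algebra.Fundamental_Theorem_Algebra"
    "Graph_Theory.Pair_Digraph"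
    "Jordan_Normal_Form.Spectral_Radius"
begin

text \<open>
  A finite simple undirected graph is a \<^const>\<open>pair_graph\<close>: a finite, loop-free, symmetric set of
  pairs on a finite vertex set. An undirected edge is the pair of its two orientations, so that the
  degree of a vertex is the number of arcs leaving it.
\<close>

definition vdegree :: "'a pair_pre_digraph \<Rightarrow> 'a \<Rightarrow> nat" where
  "vdegree G v = out_degree (with_proj G) v"

lemma vdegree_eq_card_neighbours: "vdegree G v = card {w. (v, w) \<in> parcs G}"
proof -
  have "out_arcs (with_proj G) v = Pair v ` {w. (v, w) \<in> parcs G}"
    by (auto simp: out_arcs_def)
  then show ?thesis
    by (simp add: vdegree_def out_degree_def card_image inj_on_def)
qed

text \<open>The list \<open>vs\<close> is the chosen ordering of the vertices; rows and columns are counted from 0.\<close>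

definition sombor_matrix :: "'a pair_pre_digraph \<Rightarrow> 'a list \<Rightarrow> real mat" where
  "sombor_matrix G vs = mat (length vs) (length vs)
     (\<lambda>(i, j). if (vs ! i, vs ! j) \<in> parcs G
               then sqrt ((real (vdegree G (vs ! i)))\<^sup>2 + (real (vdegree G (vs ! j)))\<^sup>2)
               else 0)"

text \<open>
  Eigenvalues are taken with algebraic multiplicity, and over the complex numbers, so that there
  are always as many of them as there are rows.
\<close>

definition eigvals_mset :: "real mat \<Rightarrow> complex multiset" where
  "eigvals_mset A = proots (char_poly (map_mat complex_of_real A))"

lemma size_eigvals_mset:
  assumes "A \<in> carrier_mat n n"
  shows "size (eigvals_mset A) = n"
  using degree_monic_char_poly[of "map_mat complex_of_real A" n] assms
  by (simp add: eigvals_mset_def size_proots_complex)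

lemma set_eigvals_mset:
  assumes "A \<in> carrier_mat n n"
  shows "set_mset (eigvals_mset A) = spectrum (map_mat complex_of_real A)"
proof -
  have A: "map_mat complex_of_real A \<in> carrier_mat n n"
    using assms by simp
  then have "char_poly (map_mat complex_of_real A) \<noteq> 0"
    using degree_monic_char_poly[OF A] by auto
  then show ?thesis
    by (auto simp: eigvals_mset_def spectrum_def eigenvalue_root_char_poly[OF A])
qed

definition sombor_energy :: "'a pair_pre_digraph \<Rightarrow> 'a list \<Rightarrow> real" where
  "sombor_energy G vs = (\<Sum>\<rho>\<in>#eigvals_mset (sombor_matrix G vs). cmod \<rho>)"

end

theory Submission
  imports Defs "HOL-Analysis.Convex"
begin

text \<open>
  By symmetry the eigenvalues are real, so the absolute eigenvalues \<open>x\<^sub>i\<close> satisfy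
  \<open>\<Sum>x\<^sub>i\<^sup>2 = tr \<S>\<^sup>2 = 2F\<close> and \<open>\<Prod>x\<^sub>i = |det \<S>|\<close>. Both bounds are then Kober's inequalities
  between \<open>(\<Sum>x\<^sub>i)\<^sup>2\<close>, \<open>\<Sum>x\<^sub>i\<^sup>2\<close> and the geometric mean of the \<open>x\<^sub>i\<^sup>2\<close>. The lower one is the
  arithmetic-geometric mean inequality for the products \<open>x\<^sub>i x\<^sub>j\<close> with \<open>i \<noteq> j\<close>; the upper one is
  proved by induction, adjoining a least element at each step.
\<close>

section \<open>Means of nonnegative reals\<close>

text \<open>This is what remains of the induction step for the upper bound once the other estimates
  are used. With \<open>g = y * exp t\<close>, dividing by \<open>y\<^sup>2\<close> turns it into
  \<open>2 * m * exp t \<le> (m - 1) + (m + 1) * exp u\<close>, which is convexity of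
  \<open>exp\<close> at the points 0 and \<open>u\<close>, whose mean with weights
  \<open>m - 1\<close> and \<open>m + 1\<close> is \<open>t\<close>.\<close>

lemma two_point_am_gm:
  fixes m g y :: real
  assumes "m \<ge> 1" "g > 0" "y > 0"
  shows "2 * m * g * y \<le> (m - 1) * y\<^sup>2 + (m + 1) * (g powr m * y) powr (2 / (m + 1))"
proof -
  define t where "t = ln (g / y)"
  define u where "u = 2 * m * t / (m + 1)"
  have g: "g = y * exp t"
    using assms by (simp add: t_def)
  have ln_y: "exp (ln y) = y"
    using assms by simp
  have "(g powr m * y) powr (2 / (m + 1)) = exp (2 / (m + 1) * (m * (ln y + t) + ln y))"
    using assms by (simp add: g powr_def ln_mult exp_add)
  also have "2 / (m + 1) * (m * (ln y + t) + ln y) = ln y + ln y + u"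
    using assms by (simp add: u_def field_simps)
  finally have h: "(g powr m * y) powr (2 / (m + 1)) = y\<^sup>2 * exp u"
    by (simp only: exp_add ln_y power2_eq_square)
  \<comment> \<open>The graph of \<open>exp\<close> lies above its tangent at \<open>t\<close>; this
    is used at \<open>u\<close> here and at 0 below.\<close>
  have "exp t * (1 + (u - t)) \<le> exp t * exp (u - t)"
    by (intro mult_left_mono) auto
  then have 1: "exp t * (1 + (u - t)) \<le> exp u"
    by (simp flip: exp_add)
  have "exp t * (1 + - t) \<le> exp t * exp (- t)"
    by (intro mult_left_mono exp_ge_add_one_self) auto
  then have 2: "exp t * (1 - t) \<le> 1"
    by (simp flip: exp_add)
  \<comment> \<open>The value of \<open>u\<close> makes the linear terms cancel:
    \<open>(m + 1) * (u - t) = (m - 1) * t\<close>.\<close>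
  have "2 * m * exp t = (m - 1) * (exp t * (1 - t)) + (m + 1) * (exp t * (1 + (u - t)))"
    using assms by (simp add: u_def field_simps)
  also have "\<dots> \<le> (m - 1) * 1 + (m + 1) * exp u"
    using 1 2 assms by (intro add_mono mult_left_mono) auto
  finally have "y\<^sup>2 * (2 * m * exp t) \<le> y\<^sup>2 * ((m - 1) * 1 + (m + 1) * exp u)"
    by (intro mult_left_mono) auto
  then show ?thesis
    by (simp add: h) (simp add: g power2_eq_square algebra_simps)
qed

lemma sum_square_le_card_mult_sum_squares:
  fixes x :: "'i \<Rightarrow> real"
  shows "(\<Sum>i\<in>S. x i)\<^sup>2 \<le> real (card S) * (\<Sum>i\<in>S. (x i)\<^sup>2)"
  using Cauchy_Schwarz_ineq_sum[of "\<lambda>_. 1" x S] by simp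

text \<open>
  For the adjoined least element \<open>y\<close>, the increments of the two sides are compared by means of
  \<open>\<Sum>(x\<^sub>i - y)\<^sup>2 \<ge> n (g - y)\<^sup>2\<close>, where \<open>g \<ge> y\<close> is the geometric mean of the other \<open>n\<close> elements.
\<close>

theorem kober_upper:
  fixes x :: "'i \<Rightarrow> real"
  assumes "finite S" "\<And>i. i \<in> S \<Longrightarrow> x i \<ge> 0"
  shows "(\<Sum>i\<in>S. x i)\<^sup>2 \<le> (real (card S) - 1) * (\<Sum>i\<in>S. (x i)\<^sup>2)
           + real (card S) * (\<Prod>i\<in>S. x i) powr (2 / real (card S))"
  using assms
\<comment> \<open>The rule adds an element of maximal rank, so ranking by \<open>- x i\<close> makes
  the new element the least one.\<close>
proof (induction S rule: finite_ranking_induct[where f = "\<lambda>i. - x i"])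
  case empty
  then show ?case by simp
next
  case (insert a S)
  show ?case
  proof (cases "a \<in> S")
    case True
    then show ?thesis
      using insert by (simp add: insert_absorb)
  next
    case a: False
    define n where "n = real (card S)"
    define y where "y = x a"
    define s where "s = (\<Sum>i\<in>S. x i)"
    define q where "q = (\<Sum>i\<in>S. (x i)\<^sup>2)"
    define p where "p = (\<Prod>i\<in>S. x i)"
    have IH: "s\<^sup>2 \<le> (n - 1) * q + n * p powr (2 / n)"
      using insert by (simp add: s_def q_def p_def n_def)
    have cs: "s\<^sup>2 \<le> n * q"
      unfolding s_def q_def n_def by (rule sum_square_le_card_mult_sum_squares)
    have y_le: "y \<le> x i" if "i \<in> S" for i
      using insert.hyps(2)[OF that] by (simp add: y_def)
    have "y \<ge> 0"
      using insert.prems by (simp add: y_def)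
    have "(y + s)\<^sup>2 \<le> n * (y\<^sup>2 + q) + (n + 1) * (y * p) powr (2 / (n + 1))"
    \<comment> \<open>The main argument divides by \<open>n\<close> and takes logarithms of
      \<open>y\<close>. If \<open>y = 0\<close>, the product term vanishes and Cauchy-Schwarz alone
      suffices.\<close>
    proof (cases "S = {} \<or> y = 0")
      case True
      then show ?thesis
      proof
        assume "S = {}"
        then show ?thesis
          using \<open>y \<ge> 0\<close> by (cases "y = 0") (simp_all add: n_def s_def q_def p_def)
      qed (use cs in simp)
    next
      case False
      then have "y > 0" "S \<noteq> {}"
        using \<open>y \<ge> 0\<close> by auto
      then have n: "n \<ge> 1"
        using \<open>finite S\<close> by (simp add: n_def Suc_le_eq card_gt_0_iff)
      have p: "p > 0"
        unfolding p_def using y_le \<open>y > 0\<close> by (intro prod_pos) (auto intro: less_le_trans)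
      define g where "g = p powr (1 / n)"
      have "g > 0"
        using p by (simp add: g_def)
      have gn: "g powr n = p" and g2: "p powr (2 / n) = g\<^sup>2"
        using p n by (simp_all add: g_def powr_powr flip: powr_numeral)
      have "y ^ card S \<le> p"
        unfolding p_def using y_le \<open>y > 0\<close> prod_mono[of S "\<lambda>_. y" x] by simp
      then have "y powr n \<le> p"
        using \<open>y > 0\<close> by (simp add: n_def powr_realpow)
      then have "(y powr n) powr (1 / n) \<le> g"
        unfolding g_def using n by (intro powr_mono2) auto
      then have "y \<le> g"
        using \<open>y > 0\<close> n by (simp add: powr_powr)
      have "g \<le> s / n"
        using arith_geom_mean[OF \<open>finite S\<close> \<open>S \<noteq> {}\<close>, of x] insert.prems
        by (simp add: g_def p_def s_def n_def sum_divide_distrib)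
      then have "n * g \<le> s"
        using n by (simp add: field_simps)
      then have "n * (g - y) \<le> s - n * y"
        by (simp add: algebra_simps)
      moreover have "0 \<le> n * (g - y)"
        using \<open>y \<le> g\<close> n by simp
      ultimately have "(n * (g - y))\<^sup>2 \<le> (s - n * y)\<^sup>2"
        by (intro power_mono)
      \<comment> \<open>The bracket is the expanded sum of the squares
        \<open>(x i - y)\<^sup>2\<close>, so this is Cauchy-Schwarz for the shifted values.\<close>
      also have "\<dots> \<le> n * (q - 2 * s * y + n * y\<^sup>2)"
        using cs by (simp add: power2_eq_square algebra_simps)
      finally have "n * (n * (g - y)\<^sup>2) \<le> n * (q - 2 * s * y + n * y\<^sup>2)"
        by (simp add: power2_eq_square algebra_simps)
      then have *: "n * (g - y)\<^sup>2 \<le> q - 2 * s * y + n * y\<^sup>2"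
        using n by simp
      \<comment> \<open>Adding \<open>*\<close> to the induction hypothesis cancels
        \<open>n * g\<^sup>2\<close> and leaves the cross term \<open>2 * n * g * y\<close>, which
        the two-point inequality absorbs.\<close>
      show ?thesis
        using * IH two_point_am_gm[OF n \<open>g > 0\<close> \<open>y > 0\<close>]
        by (simp add: g2 gn power2_eq_square algebra_simps)
    qed
    then show ?thesis
      using a \<open>finite S\<close> by (simp add: n_def y_def s_def q_def p_def add_ac)
  qed
qed

text \<open>There are \<open>n * (n - 1)\<close> ordered pairs of distinct indices, and each
  \<open>x i\<close> is a factor in \<open>2 * (n - 1)\<close> of the products
  \<open>x i * x j\<close>. Their geometric mean is therefore the product of all \<open>x i\<close>
  to the power \<open>2 / n\<close>, while their sum is the square of the sum minus the sum of
  squares.\<close>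

theorem kober_lower:
  fixes x :: "'i \<Rightarrow> real"
  assumes "finite S" "\<And>i. i \<in> S \<Longrightarrow> x i \<ge> 0"
  shows "(\<Sum>i\<in>S. (x i)\<^sup>2)
           + real (card S) * (real (card S) - 1) * (\<Prod>i\<in>S. x i) powr (2 / real (card S))
         \<le> (\<Sum>i\<in>S. x i)\<^sup>2"
proof (cases "card S \<le> 1")
  case True
  then consider "S = {}" | i where "S = {i}"
    using \<open>finite S\<close> by (metis card_0_eq card_1_singletonE le_neq_implies_less less_one)
  then show ?thesis
    by cases auto
next
  case False
  define n where "n = real (card S)"
  define T where "T = Sigma S (\<lambda>i. S - {i})"
  have n: "n > 1"
    using False by (simp add: n_def)
  have finT: "finite T"
    using \<open>finite S\<close> by (simp add: T_def)
  have cardT: "real (card T) = n * (n - 1)"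
    using \<open>finite S\<close> False by (simp add: T_def n_def of_nat_diff)
  have "T \<noteq> {}"
    using cardT n by auto
  have sumT: "(\<Sum>(i, j)\<in>T. x i * x j) = (\<Sum>i\<in>S. x i)\<^sup>2 - (\<Sum>i\<in>S. (x i)\<^sup>2)"
  proof -
    have "(\<Sum>(i, j)\<in>T. x i * x j) = (\<Sum>i\<in>S. \<Sum>j\<in>S - {i}. x i * x j)"
      using \<open>finite S\<close> by (simp add: T_def sum.Sigma)
    also have "\<dots> = (\<Sum>i\<in>S. x i * (\<Sum>j\<in>S. x j) - (x i)\<^sup>2)"
      using \<open>finite S\<close>
      by (intro sum.cong) (simp_all add: sum_diff1 power2_eq_square right_diff_distrib flip: sum_distrib_left)
    finally show ?thesis
      by (simp add: sum_subtractf power2_eq_square flip: sum_distrib_right)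
  qed
  have prodT: "(\<Prod>(i, j)\<in>T. x i * x j) = (\<Prod>i\<in>S. x i) ^ (2 * (card S - 1))"
  proof -
    \<comment> \<open>Exchanging the two coordinates maps \<open>T\<close> onto itself, so both
      factors of \<open>x i * x j\<close> contribute the same product.\<close>
    have swap: "(\<Prod>i\<in>S. \<Prod>j\<in>S - {i}. x j) = (\<Prod>i\<in>S. \<Prod>j\<in>S - {i}. x i)"
    proof -
      have "(\<Prod>i\<in>S. \<Prod>j\<in>S - {i}. x j) = (\<Prod>(i, j)\<in>T. x j)"
        using \<open>finite S\<close> by (simp add: T_def prod.Sigma)
      also have "\<dots> = (\<Prod>(i, j)\<in>T. x i)"
        by (rule prod.reindex_bij_witness[of _ prod.swap prod.swap]) (auto simp: T_def)
      also have "\<dots> = (\<Prod>i\<in>S. \<Prod>j\<in>S - {i}. x i)"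
        unfolding T_def by (rule prod.Sigma[symmetric]) (use \<open>finite S\<close> in auto)
      finally show ?thesis .
    qed
    have "(\<Prod>(i, j)\<in>T. x i * x j) = (\<Prod>i\<in>S. \<Prod>j\<in>S - {i}. x i * x j)"
      unfolding T_def by (rule prod.Sigma[symmetric]) (use \<open>finite S\<close> in auto)
    also have "\<dots> = (\<Prod>i\<in>S. \<Prod>j\<in>S - {i}. x i) * (\<Prod>i\<in>S. \<Prod>j\<in>S - {i}. x i)"
      using swap by (simp only: prod.distrib)
    also have "(\<Prod>i\<in>S. \<Prod>j\<in>S - {i}. x i) = (\<Prod>i\<in>S. x i ^ (card S - 1))"
      using \<open>finite S\<close> by (intro prod.cong) simp_all
    finally show ?thesis
      by (simp add: prod_power_distrib mult_2 power_add)
  qed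
  have P: "0 \<le> (\<Prod>i\<in>S. x i)"
    by (intro prod_nonneg) (use assms in auto)
  have powr: "((\<Prod>i\<in>S. x i) ^ (2 * (card S - 1))) powr (1 / (n * (n - 1))) = (\<Prod>i\<in>S. x i) powr (2 / n)"
  \<comment> \<open>Rewriting a natural power as \<open>powr\<close> needs a positive base. For a
    zero product both sides are 0, since \<open>card S > 1\<close> makes the natural exponent
    positive.\<close>
  proof (cases "(\<Prod>i\<in>S. x i) = 0")
    case True
    then show ?thesis
      using False by simp
  next
    case False
    have "real (2 * (card S - 1)) = 2 * (n - 1)"
      using n by (simp add: n_def of_nat_diff)
    moreover have "(\<Prod>i\<in>S. x i) ^ (2 * (card S - 1)) = (\<Prod>i\<in>S. x i) powr real (2 * (card S - 1))"
      by (rule powr_realpow[symmetric]) (use False P in simp)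
    ultimately have "((\<Prod>i\<in>S. x i) ^ (2 * (card S - 1))) powr (1 / (n * (n - 1)))
        = (\<Prod>i\<in>S. x i) powr (2 * (n - 1) * (1 / (n * (n - 1))))"
      by (simp only: powr_powr)
    also have "2 * (n - 1) * (1 / (n * (n - 1))) = 2 / n"
      using n by (simp add: field_simps)
    finally show ?thesis .
  qed
  have "(\<Prod>(i, j)\<in>T. x i * x j) powr (1 / (n * (n - 1))) \<le> (\<Sum>(i, j)\<in>T. x i * x j) / (n * (n - 1))"
    unfolding sum_divide_distrib cardT[symmetric]
    by (rule arith_geom_mean[OF finT \<open>T \<noteq> {}\<close>]) (use assms in \<open>auto simp: T_def\<close>)
  then have "(\<Prod>i\<in>S. x i) powr (2 / n) * (n * (n - 1)) \<le> (\<Sum>i\<in>S. x i)\<^sup>2 - (\<Sum>i\<in>S. (x i)\<^sup>2)"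
    using n unfolding sumT prodT powr by (simp add: pos_le_divide_eq)
  then show ?thesis
    by (simp add: n_def mult_ac)
qed

section \<open>Eigenvalues of a real matrix\<close>

definition trace_mat :: "'a::comm_semiring_1 mat \<Rightarrow> 'a" where
  "trace_mat A = (\<Sum>i<dim_row A. A $$ (i, i))"

lemma trace_mat_mult:
  assumes "A \<in> carrier_mat n m" "B \<in> carrier_mat m n"
  shows "trace_mat (A * B) = (\<Sum>i<n. \<Sum>j<m. A $$ (i, j) * B $$ (j, i))"
  using assms by (auto simp: trace_mat_def scalar_prod_def lessThan_atLeast0 intro!: sum.cong)

lemma trace_mat_mult_commute:
  assumes "A \<in> carrier_mat n m" "B \<in> carrier_mat m n"
  shows "trace_mat (A * B) = trace_mat (B * A)"
  unfolding trace_mat_mult[OF assms] trace_mat_mult[OF assms(2,1)]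
  by (subst sum.swap) (simp add: mult.commute)

text \<open>The inner \<open>Q * P\<close> cancels in the square, leaving
  \<open>P * (B * B * Q)\<close>; cyclicity of the trace then brings \<open>P\<close> next to
  \<open>Q\<close>.\<close>

lemma trace_mat_square_similar:
  fixes A B :: "'a::comm_ring_1 mat"
  assumes "similar_mat A B"
  shows "trace_mat (A * A) = trace_mat (B * B)"
proof -
  obtain n P Q where "{A, B, P, Q} \<subseteq> carrier_mat n n"
    and QP: "Q * P = 1\<^sub>m n" and A: "A = P * B * Q"
    using similar_matD[OF assms] by blast
  then have [simp]: "B \<in> carrier_mat n n" "P \<in> carrier_mat n n" "Q \<in> carrier_mat n n"
    by auto
  have "A * A = P * B * (Q * P) * B * Q"
    unfolding A by (simp add: assoc_mult_mat[of _ n n _ n _ n] mult_carrier_mat[of _ n n _ n])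
  also have "\<dots> = P * (B * B * Q)"
    unfolding QP by (simp add: left_mult_one_mat[of _ n n] assoc_mult_mat[of _ n n _ n _ n] mult_carrier_mat[of _ n n _ n])
  finally have "trace_mat (A * A) = trace_mat (P * (B * B * Q))"
    by simp
  also have "\<dots> = trace_mat (B * B * Q * P)"
    by (rule trace_mat_mult_commute[of _ n n]) (simp_all add: mult_carrier_mat[of _ n n _ n])
  also have "B * B * Q * P = B * B * (Q * P)"
    by (simp add: assoc_mult_mat[of _ n n _ n _ n] mult_carrier_mat[of _ n n _ n])
  also have "\<dots> = B * B"
    by (simp add: QP right_mult_one_mat[of _ n n] mult_carrier_mat[of _ n n _ n])
  finally show ?thesis .
qed

text \<open>For \<open>i \<noteq> j\<close> one of the entries \<open>(i, j)\<close> and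
  \<open>(j, i)\<close> lies below the diagonal, so only the squared diagonal entries
  survive.\<close>

lemma trace_mat_square_upper_triangular:
  fixes B :: "'a::comm_ring_1 mat"
  assumes B: "B \<in> carrier_mat n n" and "upper_triangular B"
  shows "trace_mat (B * B) = (\<Sum>b\<leftarrow>diag_mat B. b\<^sup>2)"
proof -
  have "B $$ (i, j) * B $$ (j, i) = (if j = i then (B $$ (i, i))\<^sup>2 else 0)" if "i < n" "j < n" for i j
    using assms that by (cases i j rule: linorder_cases) (auto simp: power2_eq_square upper_triangularD)
  then have "trace_mat (B * B) = (\<Sum>i<n. (B $$ (i, i))\<^sup>2)"
    unfolding trace_mat_mult[OF B B] by simp
  then show ?thesis
    using B by (simp add: diag_mat_def comp_def interv_sum_list_conv_sum_set_nat lessThan_atLeast0)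
qed

text \<open>Over the complex numbers the characteristic polynomial splits, so a Schur decomposition
  exists. It reduces the product and the power sum of the eigenvalues, with multiplicity, to the
  diagonal of a triangular matrix.\<close>

lemma eigvals_mset_triangular:
  assumes A: "A \<in> carrier_mat n n"
  obtains B where "B \<in> carrier_mat n n" "upper_triangular B"
    "similar_mat (map_mat complex_of_real A) B" "eigvals_mset A = mset (diag_mat B)"
proof -
  have A': "map_mat complex_of_real A \<in> carrier_mat n n"
    using A by simp
  obtain es where "char_poly (map_mat complex_of_real A) = (\<Prod>a\<leftarrow>es. [:- a, 1:])"
    using char_poly_factorized[OF A'] by blast
  then obtain B where B: "B \<in> carrier_mat n n" "upper_triangular B"
    "similar_mat (map_mat complex_of_real A) B"
    using schur_decomposition_exists[OF A'] by blast
  have "char_poly (map_mat complex_of_real A) = (\<Prod>a\<leftarrow>diag_mat B. [:- a, 1:])"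
    using char_poly_similar[OF B(3)] char_poly_upper_triangular[OF B(1,2)] by simp
  moreover have "proots (\<Prod>a\<leftarrow>bs. [:- a, 1:]) = mset bs" for bs :: "complex list"
  proof (induction bs)
    case (Cons b bs)
    have "(\<Prod>a\<leftarrow>bs. [:- a, 1:]) \<noteq> 0"
      by (auto simp: prod_list_zero_iff)
    then show ?case
      using Cons by (simp add: proots_mult del: mult_pCons_left)
  qed simp
  ultimately have "eigvals_mset A = mset (diag_mat B)"
    by (simp add: eigvals_mset_def)
  with B show ?thesis
    by (rule that)
qed

lemma prod_eigvals_mset:
  assumes "A \<in> carrier_mat n n"
  shows "prod_mset (eigvals_mset A) = complex_of_real (Determinant.det A)"
proof -
  obtain B where "B \<in> carrier_mat n n" "upper_triangular B"
    "similar_mat (map_mat complex_of_real A) B" "eigvals_mset A = mset (diag_mat B)"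
    using eigvals_mset_triangular[OF assms] .
  then show ?thesis
    using det_similar[of "map_mat complex_of_real A" B] det_upper_triangular[of B n]
    by (simp add: prod_mset_prod_list of_real_hom.hom_det)
qed

lemma sum_squares_eigvals_mset:
  assumes A: "A \<in> carrier_mat n n"
  shows "(\<Sum>\<rho>\<in>#eigvals_mset A. \<rho>\<^sup>2) = complex_of_real (trace_mat (A * A))"
proof -
  obtain B where B: "B \<in> carrier_mat n n" "upper_triangular B"
    "similar_mat (map_mat complex_of_real A) B" "eigvals_mset A = mset (diag_mat B)"
    using eigvals_mset_triangular[OF A] .
  have "(\<Sum>\<rho>\<in>#eigvals_mset A. \<rho>\<^sup>2) = trace_mat (B * B)"
    unfolding B(4) trace_mat_square_upper_triangular[OF B(1,2)] by (simp flip: sum_mset_sum_list)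
  also have "\<dots> = trace_mat (map_mat complex_of_real A * map_mat complex_of_real A)"
    using trace_mat_square_similar[OF B(3)] by simp
  also have "\<dots> = trace_mat (map_mat complex_of_real (A * A))"
    by (simp add: of_real_hom.mat_hom_mult[OF A A])
  also have "\<dots> = complex_of_real (trace_mat (A * A))"
    using A by (simp add: trace_mat_def)
  finally show ?thesis .
qed

text \<open>For an eigenvector \<open>v\<close>, the Hermitian form \<open>R\<close> of
  \<open>A\<close> at \<open>v\<close> equals \<open>\<rho>\<close> times the squared norm
  \<open>N > 0\<close>. Since \<open>A\<close> is real and symmetric, \<open>R\<close> is its own
  conjugate, and hence so is \<open>\<rho>\<close>.\<close>

lemma eigvals_mset_symmetric_real:
  assumes A: "A \<in> carrier_mat n n" and sym: "\<And>i j. i < n \<Longrightarrow> j < n \<Longrightarrow> A $$ (i, j) = A $$ (j, i)"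
    and "\<rho> \<in># eigvals_mset A"
  shows "\<rho> \<in> \<real>"
proof -
  have "eigenvalue (map_mat complex_of_real A) \<rho>"
    using assms set_eigvals_mset[OF A] by (auto simp: spectrum_def)
  then obtain v where v: "v \<in> carrier_vec n" "v \<noteq> 0\<^sub>v n"
    and ev: "map_mat complex_of_real A *\<^sub>v v = \<rho> \<cdot>\<^sub>v v"
    using A by (auto simp: eigenvalue_def eigenvector_def)
  have ev_i: "(\<Sum>j<n. complex_of_real (A $$ (i, j)) * v $ j) = \<rho> * v $ i" if "i < n" for i
  proof -
    have "(map_mat complex_of_real A *\<^sub>v v) $ i = (\<rho> \<cdot>\<^sub>v v) $ i"
      using ev by simp
    then show ?thesis
      using that A v(1) by (simp add: scalar_prod_def lessThan_atLeast0)
  qed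
  define N where "N = (\<Sum>i<n. (cmod (v $ i))\<^sup>2)"
  define R where "R = (\<Sum>i<n. \<Sum>j<n. cnj (v $ i) * (complex_of_real (A $$ (i, j)) * v $ j))"
  have R: "R = \<rho> * complex_of_real N"
  proof -
    have "R = (\<Sum>i<n. cnj (v $ i) * (\<rho> * v $ i))"
      unfolding R_def sum_distrib_left[symmetric] using ev_i by simp
    also have "\<dots> = (\<Sum>i<n. \<rho> * complex_of_real ((cmod (v $ i))\<^sup>2))"
      by (intro sum.cong) (simp_all only: complex_norm_square mult_ac)
    finally show ?thesis
      by (simp add: N_def sum_distrib_left)
  qed
  \<comment> \<open>Conjugation fixes the real entries and exchanges the roles of \<open>i\<close>
    and \<open>j\<close>; swapping the sums and using symmetry restores \<open>R\<close>.\<close>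
  have "cnj R = (\<Sum>i<n. \<Sum>j<n. cnj (v $ j) * (complex_of_real (A $$ (i, j)) * v $ i))"
    by (simp add: R_def mult_ac)
  also have "\<dots> = R"
    unfolding R_def by (subst sum.swap) (auto intro!: sum.cong simp: sym)
  finally have "cnj (\<rho> * complex_of_real N) = \<rho> * complex_of_real N"
    using R by simp
  moreover have "N \<noteq> 0"
  proof
    assume "N = 0"
    then have "\<forall>i<n. v $ i = 0"
      by (simp add: N_def sum_nonneg_eq_0_iff)
    then have "v = 0\<^sub>v n"
      using v(1) by (intro eq_vecI) auto
    with v(2) show False ..
  qed
  ultimately have "cnj \<rho> = \<rho>"
    by simp
  then show ?thesis
    by (simp add: Reals_cnj_iff)
qed

section \<open>The Sombor matrix\<close>

text \<open>The trace adds \<open>(d u)\<^sup>2 + (d v)\<^sup>2\<close> over all ordered adjacent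
  pairs. Each vertex \<open>u\<close> occurs \<open>d u\<close> times in either position, which
  gives \<open>d u ^ 3\<close> twice.\<close>

lemma trace_sombor_matrix_square:
  assumes "pair_graph G" and "distinct vs" and vs: "set vs = pverts G"
  shows "trace_mat (sombor_matrix G vs * sombor_matrix G vs)
           = 2 * (\<Sum>v\<in>pverts G. real (vdegree G v) ^ 3)"
proof -
  interpret pair_graph G by fact
  define d where "d v = real (vdegree G v)" for v
  define V where "V = pverts G"
  define E where "E u v = (if (u, v) \<in> parcs G then 1 else 0 :: real)" for u v
  have sym: "(u, v) \<in> parcs G \<longleftrightarrow> (v, u) \<in> parcs G" for u v
    using arcs_symmetric by blast
  have E_sym: "E u v = E v u" for u v
    using sym by (simp add: E_def)
  have [simp]: "finite V"
    by (simp add: V_def)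
  have deg: "(\<Sum>v\<in>V. E u v) = d u" for u
  proof -
    have "{v. (u, v) \<in> parcs G} = {v \<in> V. (u, v) \<in> parcs G}"
      using in_arcsD2 by (auto simp: V_def)
    then show ?thesis
      by (simp add: d_def E_def vdegree_eq_card_neighbours sum.If_cases Int_def)
  qed
  have carr: "sombor_matrix G vs \<in> carrier_mat (length vs) (length vs)"
    by (simp add: sombor_matrix_def)
  \<comment> \<open>The list enumerates each vertex exactly once, so sums over matrix indices become
    sums over vertices.\<close>
  have bij: "bij_betw ((!) vs) {..<length vs} V"
    using bij_betw_nth[OF \<open>distinct vs\<close>] vs by (auto simp: V_def)
  have "trace_mat (sombor_matrix G vs * sombor_matrix G vs)
      = (\<Sum>i<length vs. \<Sum>j<length vs. E (vs ! i) (vs ! j) * ((d (vs ! i))\<^sup>2 + (d (vs ! j))\<^sup>2))"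
    unfolding trace_mat_mult[OF carr carr]
    by (intro sum.cong refl) (use sym in \<open>auto simp: sombor_matrix_def E_def d_def add_ac\<close>)
  also have "\<dots> = (\<Sum>i<length vs. \<Sum>v\<in>V. E (vs ! i) v * ((d (vs ! i))\<^sup>2 + (d v)\<^sup>2))"
    by (intro sum.cong refl sum.reindex_bij_betw[OF bij])
  also have "\<dots> = (\<Sum>u\<in>V. \<Sum>v\<in>V. E u v * ((d u)\<^sup>2 + (d v)\<^sup>2))"
    by (rule sum.reindex_bij_betw[OF bij])
  also have "\<dots> = (\<Sum>u\<in>V. \<Sum>v\<in>V. E u v * (d u)\<^sup>2) + (\<Sum>u\<in>V. \<Sum>v\<in>V. E u v * (d v)\<^sup>2)"
    by (simp add: distrib_left sum.distrib)
  also have "(\<Sum>u\<in>V. \<Sum>v\<in>V. E u v * (d v)\<^sup>2) = (\<Sum>u\<in>V. \<Sum>v\<in>V. E u v * (d u)\<^sup>2)"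
    by (subst sum.swap) (simp add: E_sym)
  also have "(\<Sum>u\<in>V. \<Sum>v\<in>V. E u v * (d u)\<^sup>2) = (\<Sum>u\<in>V. d u ^ 3)"
    unfolding sum_distrib_right[symmetric] deg by (simp add: power2_eq_square power3_eq_cube mult_ac)
  finally show ?thesis
    by (simp add: V_def d_def)
qed

theorem theorem4p1:
  fixes G :: "'a pair_pre_digraph" and vs :: "'a list" and n :: nat and F :: real
  assumes "pair_graph G"
    and "distinct vs" and "set vs = pverts G"
    and "n = card (pverts G)"
    and "F = (\<Sum>v\<in>pverts G. real (vdegree G v) ^ 3)"
  shows "sqrt (2 * F + real n * (real n - 1) * \<bar>Determinant.det (sombor_matrix G vs)\<bar> powr (2 / real n))
           \<le> sombor_energy G vs
       \<and> sombor_energy G vs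
           \<le> sqrt (2 * (real n - 1) * F + real n * \<bar>Determinant.det (sombor_matrix G vs)\<bar> powr (2 / real n))"
proof -
  interpret pair_graph G by fact
  let ?A = "sombor_matrix G vs"
  have "length vs = n"
    using assms distinct_card by fastforce
  then have A: "?A \<in> carrier_mat n n"
    by (simp add: sombor_matrix_def)
  \<comment> \<open>Listing the eigenvalues turns the multiset into a family indexed by
    \<open>{..<n}\<close>, to which the Kober inequalities apply with repetitions kept.\<close>
  obtain es where es: "eigvals_mset ?A = mset es"
    by (metis ex_mset)
  have len: "length es = n"
    using size_eigvals_mset[OF A] es by simp
  define x where "x i = cmod (es ! i)" for i
  have "?A $$ (i, j) = ?A $$ (j, i)" if "i < n" "j < n" for i j
    using that \<open>length vs = n\<close> arcs_symmetric by (auto simp: sombor_matrix_def add.commute)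
  then have real: "\<rho> \<in> \<real>" if "\<rho> \<in> set es" for \<rho>
    using eigvals_mset_symmetric_real[OF A, of \<rho>] es that by auto
  have sum_eigvals: "(\<Sum>\<rho>\<in>#eigvals_mset ?A. f \<rho>) = (\<Sum>i<n. f (es ! i))"
    for f :: "complex \<Rightarrow> 'b::comm_monoid_add"
  proof -
    have "(\<Sum>\<rho>\<in>#eigvals_mset ?A. f \<rho>) = sum_list (map f es)"
      by (simp add: es flip: sum_mset_sum_list)
    then show ?thesis
      using len by (simp add: sum_list_sum_nth lessThan_atLeast0)
  qed
  have energy: "sombor_energy G vs = (\<Sum>i<n. x i)"
    unfolding sombor_energy_def x_def by (rule sum_eigvals)
  have det: "\<bar>Determinant.det ?A\<bar> = (\<Prod>i<n. x i)"
  proof -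
    have "complex_of_real (Determinant.det ?A) = (\<Prod>i<n. es ! i)"
      using prod_eigvals_mset[OF A] len
      by (simp add: es prod_mset_prod_list prod.list_conv_set_nth lessThan_atLeast0)
    then have "cmod (complex_of_real (Determinant.det ?A)) = (\<Prod>i<n. x i)"
      by (simp add: x_def prod_norm)
    then show ?thesis
      by simp
  qed
  have F: "(\<Sum>i<n. (x i)\<^sup>2) = 2 * F"
  proof -
    \<comment> \<open>This is where the eigenvalues have to be real: in general the square of the
      modulus of a complex number differs from its square.\<close>
    have "complex_of_real (\<Sum>i<n. (x i)\<^sup>2) = (\<Sum>i<n. (es ! i)\<^sup>2)"
      unfolding of_real_sum
    proof (intro sum.cong refl)
      fix i assume "i \<in> {..<n}"
      then have "es ! i \<in> \<real>"
        using real len by simp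
      then obtain r where "es ! i = complex_of_real r"
        by (auto elim: Reals_cases)
      then show "complex_of_real ((x i)\<^sup>2) = (es ! i)\<^sup>2"
        by (simp add: x_def flip: of_real_power)
    qed
    also have "\<dots> = (\<Sum>\<rho>\<in>#eigvals_mset ?A. \<rho>\<^sup>2)"
      by (rule sum_eigvals[symmetric])
    also have "\<dots> = complex_of_real (2 * F)"
      using sum_squares_eigvals_mset[OF A] trace_sombor_matrix_square[OF assms(1-3)] assms(5) by simp
    finally show ?thesis
      by (simp only: of_real_eq_iff)
  qed
  have x: "x i \<ge> 0" for i
    by (simp add: x_def)
  show ?thesis
  proof
    show "sqrt (2 * F + real n * (real n - 1) * \<bar>Determinant.det ?A\<bar> powr (2 / real n)) \<le> sombor_energy G vs"
      using kober_lower[of "{..<n}" x] x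
      by (intro real_le_lsqrt) (auto simp: energy det F intro: sum_nonneg)
    show "sombor_energy G vs \<le> sqrt (2 * (real n - 1) * F + real n * \<bar>Determinant.det ?A\<bar> powr (2 / real n))"
      using kober_upper[of "{..<n}" x] x
      by (intro real_le_rsqrt) (auto simp: energy det F algebra_simps)
  qed
qed

end
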